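(* Let $p:E\to B$ be a fibration and let $Z$ be a topological space. Then $$\mathrm{secat}(p\times 1_Z)=\mathrm{secat}(p),$$ where $p\times 1_Z:E\times Z\to B\times Z$.
   Context: Fibrations are taken in the Hurewicz sense. $1_Z:Z\to Z$ is the identity map. For a fibration $p:E\to B$, the sectional category $\mathrm{secat}(p)$ is the minimal cardinality of an open cover of $B$ such that over each member $U$ there is a continuous local section $s:U\to E$ (i.e. $p\circ s$ is the inclusion $U\hookrightarrow B$); $\mathrm{secat}(p)=\infty$ if no finite such cover exists.
   Formalization: The space Z is assumed nonempty; for Z empty the product B × Z is empty and has sectional category 0, while secat(p) is at least 1 whenever B is nonempty, so the equality fails. *)

theory Defs
  imports "HOL-Analysis.Analysis" "HOL-Library.Extended_Nat"
begin

definition homotopy_lifting ::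
  "'x topology \<Rightarrow> 'e topology \<Rightarrow> 'b topology \<Rightarrow> ('e \<Rightarrow> 'b) \<Rightarrow> bool" where
  "homotopy_lifting X E B p \<longleftrightarrow>
     (\<forall>f h. continuous_map X E f \<and>
            continuous_map (prod_topology (top_of_set {0..1::real}) X) B h \<and>
            (\<forall>x\<in>topspace X. h (0, x) = p (f x)) \<longrightarrow>
        (\<exists>k. continuous_map (prod_topology (top_of_set {0..1::real}) X) E k \<and>
             (\<forall>x\<in>topspace X. k (0, x) = f x) \<and>
             (\<forall>t\<in>{0..1}. \<forall>x\<in>topspace X. p (k (t, x)) = h (t, x))))"

text \<open>
  A Hurewicz fibration has the homotopy lifting property for all spaces. A definition cannot
  quantify over all carrier types, so the test spaces are those on the type
  \<^typ>\<open>'e \<times> (real \<Rightarrow> 'b)\<close>, which contains the pairs of a point of the total space and a path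
  in the base. Nothing is lost: \<open>hurewicz_fibration_homotopy_lifting\<close> below derives the
  property for spaces on an arbitrary type.
\<close>

definition hurewicz_fibration :: "'e topology \<Rightarrow> 'b topology \<Rightarrow> ('e \<Rightarrow> 'b) \<Rightarrow> bool" where
  "hurewicz_fibration E B p \<longleftrightarrow>
     continuous_map E B p \<and>
     (\<forall>X :: ('e \<times> (real \<Rightarrow> 'b)) topology. homotopy_lifting X E B p)"

definition has_local_section ::
  "'e topology \<Rightarrow> 'b topology \<Rightarrow> ('e \<Rightarrow> 'b) \<Rightarrow> 'b set \<Rightarrow> bool" where
  "has_local_section E B p U \<longleftrightarrow>
     (\<exists>s. continuous_map (subtopology B U) E s \<and> (\<forall>b\<in>U. p (s b) = b))"

text \<open>The infimum of the empty set is \<^term>\<open>\<infinity> :: enat\<close>; otherwise the infimum is attained.\<close>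

definition secat :: "'e topology \<Rightarrow> 'b topology \<Rightarrow> ('e \<Rightarrow> 'b) \<Rightarrow> enat" where
  "secat E B p =
     Inf {enat (card \<U>) | \<U>. finite \<U> \<and> \<Union>\<U> = topspace B \<and>
                           (\<forall>U\<in>\<U>. openin B U \<and> has_local_section E B p U)}"

lemma quotient_map_exists:
  fixes X :: "'x topology" and g :: "'x \<Rightarrow> 'y"
  shows "\<exists>Y. quotient_map X Y g"
proof -
  define Q where "Q = (\<lambda>U. U \<subseteq> g ` topspace X \<and> openin X {x \<in> topspace X. g x \<in> U})"
  have "istopology Q"
    unfolding istopology_def
  proof (intro conjI allI impI)
    fix S T assume "Q S" "Q T"
    moreover have "{x \<in> topspace X. g x \<in> S \<inter> T}
        = {x \<in> topspace X. g x \<in> S} \<inter> {x \<in> topspace X. g x \<in> T}" by blast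
    ultimately show "Q (S \<inter> T)" unfolding Q_def by auto
  next
    fix K assume K: "\<forall>S\<in>K. Q S"
    have "{x \<in> topspace X. g x \<in> \<Union>K} = (\<Union>S\<in>K. {x \<in> topspace X. g x \<in> S})" by blast
    then show "Q (\<Union>K)" using K unfolding Q_def by auto
  qed
  then have op: "openin (topology Q) = Q" by (rule topology_inverse')
  have "{x \<in> topspace X. g x \<in> g ` topspace X} = topspace X" by blast
  then have "Q (g ` topspace X)" unfolding Q_def by simp
  then have "topspace (topology Q) = g ` topspace X"
    unfolding topspace_def op using Q_def by blast
  then have "quotient_map X (topology Q) g"
    unfolding quotient_map_def op by (auto simp: Q_def)
  then show ?thesis ..
qed

lemma hurewicz_fibration_homotopy_lifting:
  fixes X :: "'x topology"
  assumes "hurewicz_fibration E B p"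
  shows "homotopy_lifting X E B p"
  unfolding homotopy_lifting_def
proof (intro allI impI, elim conjE)
  fix f h
  let ?I = "top_of_set {0..1::real}"
  assume f: "continuous_map X E f" and h: "continuous_map (prod_topology ?I X) B h"
    and 0: "\<forall>x\<in>topspace X. h (0, x) = p (f x)"
  define g where "g = (\<lambda>x. (f x, \<lambda>t. h (t, x)))"
  obtain Y where Y: "quotient_map X Y g" using quotient_map_exists by blast
  have top: "topspace Y = g ` topspace X" using Y by (simp add: quotient_map_def)
  have "compact_space ?I" by (simp add: compact_space_subtopology)
  then have "locally_compact_space ?I" by (rule compact_imp_locally_compact_space)
  moreover have "Hausdorff_space ?I" by (simp add: Hausdorff_space_subtopology)
  ultimately have q: "quotient_map (prod_topology ?I X) (prod_topology ?I Y) (\<lambda>(t, x). (t, g x))"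
    using Y by (intro quotient_map_prod_right) auto
  have 1: "continuous_map Y E fst"
    using continuous_compose_quotient_map_eq[OF Y, of E fst] f by (simp add: g_def comp_def)
  have 2: "continuous_map (prod_topology ?I Y) B (\<lambda>(t, y). snd y t)"
    using continuous_compose_quotient_map_eq[OF q, of B "\<lambda>(t, y). snd y t"] h
    by (simp add: g_def comp_def case_prod_unfold)
  have "homotopy_lifting Y E B p"
    using assms by (simp add: hurewicz_fibration_def)
  then obtain k where k: "continuous_map (prod_topology ?I Y) E k"
    "\<forall>y\<in>topspace Y. k (0, y) = fst y"
    "\<forall>t\<in>{0..1}. \<forall>y\<in>topspace Y. p (k (t, y)) = snd y t"
    unfolding homotopy_lifting_def using 1 2 0 top
    by (elim allE[where x=fst] allE[where x="\<lambda>(t, y). snd y t"]) (auto simp: g_def)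
  have "continuous_map (prod_topology ?I X) E (k \<circ> (\<lambda>(t, x). (t, g x)))"
    using quotient_imp_continuous_map[OF q] k(1) by (rule continuous_map_compose)
  then show "\<exists>k. continuous_map (prod_topology ?I X) E k \<and>
             (\<forall>x\<in>topspace X. k (0, x) = f x) \<and>
             (\<forall>t\<in>{0..1}. \<forall>x\<in>topspace X. p (k (t, x)) = h (t, x))"
    using k(2,3) top by (intro exI[of _ "k \<circ> (\<lambda>(t, x). (t, g x))"]) (auto simp: g_def)
qed

end

theory Submission
  imports Defs
begin

text \<open>
  Choose a point \<open>z\<^sub>0\<close> of \<open>Z\<close>. The projection \<open>B \<times> Z \<rightarrow> B\<close> and the slice inclusion
  \<open>b \<mapsto> (b, z\<^sub>0)\<close> both pull open covers back to open covers, and neither increases the number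
  of members. They pull local sections back as well: a section \<open>s\<close> of \<open>p\<close> gives the section
  \<open>(b, z) \<mapsto> (s b, z)\<close> of \<open>p \<times> 1\<close>, and a section \<open>\<sigma>\<close> of \<open>p \<times> 1\<close> gives the section
  \<open>b \<mapsto> fst (\<sigma> (b, z\<^sub>0))\<close> of \<open>p\<close>. So each of the two sectional categories bounds the other,
  by \<open>secat_le_if_sections_pull_back\<close> applied to either map.
\<close>

text \<open>
  Preimages under \<open>g\<close> turn a cover of \<open>B\<close> admissible for \<open>p\<close> into one of \<open>B'\<close> admissible for
  \<open>p'\<close>; distinct members may acquire the same preimage, so the cardinality can only drop. The
  model case is the pullback \<open>p'\<close> of \<open>p\<close> along \<open>g\<close>, but only its effect on local sections enters.
\<close>
lemma secat_le_if_sections_pull_back: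
  assumes g: "continuous_map B' B g"
    and sec: "\<And>U. has_local_section E B p U \<Longrightarrow>
                has_local_section E' B' p' {b \<in> topspace B'. g b \<in> U}"
  shows "secat E' B' p' \<le> secat E B p"
  unfolding secat_def[of E B p]
proof (rule Inf_greatest, clarify)
  fix \<U> assume \<U>: "finite \<U>" "\<Union>\<U> = topspace B"
    "\<forall>U\<in>\<U>. openin B U \<and> has_local_section E B p U"
  define F where "F U = {b \<in> topspace B'. g b \<in> U}" for U
  have "\<Union>(F ` \<U>) = topspace B'"
  proof -
    have "\<Union>(F ` \<U>) = {b \<in> topspace B'. g b \<in> \<Union>\<U>}" unfolding F_def by blast
    also have "\<dots> = topspace B'"
      using continuous_map_image_subset_topspace[OF g] unfolding \<U>(2) by blast
    finally show ?thesis .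
  qed
  moreover have "\<forall>V\<in>F ` \<U>. openin B' V \<and> has_local_section E' B' p' V"
    using \<U>(3) unfolding F_def by (auto intro: openin_continuous_map_preimage[OF g] sec)
  ultimately have "secat E' B' p' \<le> enat (card (F ` \<U>))"
    unfolding secat_def using \<U>(1) by (intro Inf_lower CollectI exI[of _ "F ` \<U>"]) simp
  also have "\<dots> \<le> enat (card \<U>)"
    using card_image_le[OF \<U>(1)] by simp
  finally show "secat E' B' p' \<le> enat (card \<U>)" .
qed

lemma has_local_section_prod_id:
  assumes "has_local_section E B p U"
  shows "has_local_section (prod_topology E Z) (prod_topology B Z) (map_prod p id)
           {w \<in> topspace (prod_topology B Z). fst w \<in> U}"
proof -
  obtain s where s: "continuous_map (subtopology B U) E s" "\<forall>b\<in>U. p (s b) = b"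
    using assms unfolding has_local_section_def by blast
  let ?V = "{w \<in> topspace (prod_topology B Z). fst w \<in> U}"
  let ?W = "subtopology (prod_topology B Z) ?V"
  have "continuous_map ?W (subtopology B U) fst"
    by (auto simp: continuous_map_in_subtopology continuous_map_from_subtopology
        continuous_map_fst)
  from continuous_map_compose[OF this s(1)]
  have "continuous_map ?W E (\<lambda>w. s (fst w))" by (simp add: comp_def)
  moreover have "continuous_map ?W Z snd"
    by (simp add: continuous_map_from_subtopology continuous_map_snd)
  ultimately have "continuous_map ?W (prod_topology E Z) (\<lambda>w. (s (fst w), snd w))"
    by (simp add: continuous_map_pairedI)
  then show ?thesis
    unfolding has_local_section_def using s(2) by force
qed

lemma has_local_section_slice:
  assumes "z\<^sub>0 \<in> topspace Z"
    and "has_local_section (prod_topology E Z) (prod_topology B Z) (map_prod p id) V"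
  shows "has_local_section E B p {b \<in> topspace B. (b, z\<^sub>0) \<in> V}"
proof -
  obtain \<sigma> where
    \<sigma>: "continuous_map (subtopology (prod_topology B Z) V) (prod_topology E Z) \<sigma>"
       "\<forall>w\<in>V. map_prod p id (\<sigma> w) = w"
    using assms(2) unfolding has_local_section_def by blast
  let ?U = "{b \<in> topspace B. (b, z\<^sub>0) \<in> V}"
  have "continuous_map (subtopology B ?U) (prod_topology B Z) (\<lambda>b. (b, z\<^sub>0))"
    using assms(1) by (intro continuous_map_from_subtopology continuous_map_pairedI) auto
  then have "continuous_map (subtopology B ?U) (subtopology (prod_topology B Z) V)
      (\<lambda>b. (b, z\<^sub>0))"
    by (auto simp: continuous_map_in_subtopology)
  from continuous_map_compose[OF continuous_map_compose[OF this \<sigma>(1)] continuous_map_fst]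
  have "continuous_map (subtopology B ?U) E (\<lambda>b. fst (\<sigma> (b, z\<^sub>0)))" by (simp add: comp_def)
  moreover have "\<forall>b\<in>?U. p (fst (\<sigma> (b, z\<^sub>0))) = b"
    using \<sigma>(2) by (metis (mono_tags, lifting) fst_conv fst_map_prod mem_Collect_eq)
  ultimately show ?thesis
    unfolding has_local_section_def by (intro exI conjI)
qed

theorem proposition3p6:
  fixes E :: "'e topology" and B :: "'b topology" and Z :: "'z topology"
    and p :: "'e \<Rightarrow> 'b"
  assumes "hurewicz_fibration E B p"
    and "topspace Z \<noteq> {}"
  shows "secat (prod_topology E Z) (prod_topology B Z) (map_prod p id) = secat E B p"
proof (rule antisym)
  show "secat (prod_topology E Z) (prod_topology B Z) (map_prod p id) \<le> secat E B p"
    by (rule secat_le_if_sections_pull_back[OF continuous_map_fst has_local_section_prod_id])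
next
  obtain z\<^sub>0 where z\<^sub>0: "z\<^sub>0 \<in> topspace Z" using assms(2) by blast
  then have "continuous_map B (prod_topology B Z) (\<lambda>b. (b, z\<^sub>0))"
    by (intro continuous_map_pairedI) auto
  then show "secat E B p \<le> secat (prod_topology E Z) (prod_topology B Z) (map_prod p id)"
    by (rule secat_le_if_sections_pull_back[OF _ has_local_section_slice[OF z\<^sub>0]])
qed

end
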